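(* Let $N$ be a non-negative integer. Then the Hahn polynomials $h_n^{\alpha,\beta}(x;N)$, $n\ge 0$, satisfy the following properties. (i) $h_{-1}^{\alpha,\beta}(x;N)=0$, $h_0^{\alpha,\beta}(x;N)=1$, and for $n=0,1,2,\dots$ $$x\,h_n^{\alpha,\beta}(x;N)=h_{n+1}^{\alpha,\beta}(x;N)+\beta_n h_n^{\alpha,\beta}(x;N)+\gamma_n h_{n-1}^{\alpha,\beta}(x;N),$$ where $$\beta_n=\frac{(\alpha+1)N(\alpha+\beta)+n(2N-\alpha+\beta)(\alpha+\beta+n+1)}{(\alpha+\beta+2n)(\alpha+\beta+2n+2)},$$ $$\gamma_n=\frac{n(N+1-n)(\alpha+\beta+n)(\alpha+n)(\beta+n)(\alpha+\beta+N+n+1)}{(\alpha+\beta+2n-1)(\alpha+\beta+2n)^2(\alpha+\beta+2n+1)}.$$ (ii) For any integer $k$, $0\le k\le n$, $$\Delta^k h_n^{\alpha,\beta}(x;N)=(n-k+1)_k\,h_{n-k}^{\alpha+k,\beta+k}(x;N-k),$$ $$\nabla^k h_n^{\alpha,\beta}(x;N)=(n-k+1)_k\,h_{n-k}^{\alpha+k,\beta+k}(x-k;N-k).$$ (iii) Second order linear difference equation: with $\lambda_n=n(n+\alpha+\beta+1)$, $$x(\beta+N+1-x)\nabla\Delta h_n^{\alpha,\beta}(x;N)+\big((\alpha+1)N-(\alpha+\beta+2)x\big)\Delta h_n^{\alpha,\beta}(x;N)+\lambda_n h_n^{\alpha,\beta}(x;N)=0.$$ (iv) Rodrigues formula: $$h_n^{\alpha,\beta}(x;N)\,\rho^{\alpha,\beta}(x;N)=\frac{(-1)^n}{(\alpha+\beta+n+1)_n}\nabla^n\big(\rho^{\alpha+n,\beta+n}(x;N-n)\big),\qquad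 \rho^{\alpha,\beta}(x;N)=\frac{\Gamma(\beta+N+1-x)\Gamma(\alpha+1+x)}{\Gamma(1+x)\Gamma(N+1-x)}.$$ (v) Generating function: $$\sum_{n=0}^{\infty}\frac{(\alpha+\beta+n+1)_n}{(\beta+1)_n(\alpha+1)_n\,n!}\,h_n^{\alpha,\beta}(x;N)\,t^n={}_1F_1\!\left(\begin{array}{c}-x\\ \alpha+1\end{array}\Big|-t\right){}_1F_1\!\left(\begin{array}{c}-N+x\\ \beta+1\end{array}\Big|\,t\right),$$ valid for $x\in\mathbb{C}$ and $-\alpha-1,-\beta-1\notin\{0,1,2,\dots\}$.
   Context: $(a)_0=1$, $(a)_n=a(a+1)\cdots(a+n-1)$; $\Delta f(x)=f(x+1)-f(x)$, $\nabla f(x)=f(x)-f(x-1)$; ${}_1F_1$ is the confluent hypergeometric series; $\alpha,\beta$ are complex parameters. Monic Hahn polynomials of every degree $n\ge0$ are defined by the following expression (used also when the last parameter is a negative integer, as may occur in (ii)): $$h_n^{\alpha,\beta}(x;N)=\frac{(\alpha+1)_n}{(\alpha+\beta+n+1)_n}\sum_{k=0}^n\frac{(-n)_k(\alpha+\beta+n+1)_k(-x)_k\,(-N+k)_{n-k}}{(\alpha+1)_k\,k!},$$ where $(\alpha+1)_n/(\alpha+1)_k$ is read as $(\alpha+1+k)_{n-k}$. Apparently the conditions $-\alpha,-\beta,-\alpha-\beta\notin\{1,2,\dots\}$ are necessary in (i)–(iv), but this problem disappears by using a suitable normalization, for instance one with polynomial dependence on the parameters. *)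

theory Defs
  imports "HOL-Analysis.Analysis"
begin

definition fwd_diff :: "(complex \<Rightarrow> complex) \<Rightarrow> complex \<Rightarrow> complex" where
  "fwd_diff f x = f (x + 1) - f x"

definition bwd_diff :: "(complex \<Rightarrow> complex) \<Rightarrow> complex \<Rightarrow> complex" where
  "bwd_diff f x = f x - f (x - 1)"

text \<open>
  The Hahn polynomial with the normalising denominator \<open>(\<alpha> + \<beta> + n + 1)\<^sub>n\<close> cleared, which is
  polynomial in all the parameters; the quotient \<open>(\<alpha> + 1)\<^sub>n / (\<alpha> + 1)\<^sub>k\<close> is written in the
  cancelled form \<open>(\<alpha> + 1 + k)\<^sub>n\<^sub>-\<^sub>k\<close>.
\<close>

definition hahn_cleared :: "nat \<Rightarrow> complex \<Rightarrow> complex \<Rightarrow> int \<Rightarrow> complex \<Rightarrow> complex" where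
  "hahn_cleared n \<alpha> \<beta> N x =
     (\<Sum>k\<le>n. pochhammer (- of_nat n) k * pochhammer (\<alpha> + \<beta> + of_nat n + 1) k * pochhammer (- x) k
            * pochhammer (- of_int N + of_nat k) (n - k)
            * pochhammer (\<alpha> + 1 + of_nat k) (n - k) / fact k)"

text \<open>
  The monic Hahn polynomial. The degree is an integer so that \<open>h\<^sub>-\<^sub>1 = 0\<close> can be expressed, and \<open>N\<close> is
  an integer because \<open>N - k\<close> with \<open>k > N\<close> occurs in the difference formulas.
  The definition is meaningful only if \<open>hahn_exists\<close> holds; otherwise the denominator vanishes.
\<close>

definition hahn :: "int \<Rightarrow> complex \<Rightarrow> complex \<Rightarrow> int \<Rightarrow> complex \<Rightarrow> complex" where
  "hahn n \<alpha> \<beta> N x =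
     (if n < 0 then 0
      else hahn_cleared (nat n) \<alpha> \<beta> N x / pochhammer (\<alpha> + \<beta> + of_int n + 1) (nat n))"

definition hahn_exists :: "nat \<Rightarrow> complex \<Rightarrow> complex \<Rightarrow> bool" where
  "hahn_exists n \<alpha> \<beta> \<longleftrightarrow> pochhammer (\<alpha> + \<beta> + of_nat n + 1) n \<noteq> 0"

text \<open>
  For \<open>n = 0\<close> the factor \<open>\<alpha> + \<beta>\<close> of the general formula cancels. The case is separated
  because the uncancelled quotient would be \<open>0 / 0 = 0\<close> when \<open>\<alpha> + \<beta> = 0\<close>.
\<close>

definition hahn_beta :: "nat \<Rightarrow> complex \<Rightarrow> complex \<Rightarrow> int \<Rightarrow> complex" where
  "hahn_beta n \<alpha> \<beta> N =
     (if n = 0 then (\<alpha> + 1) * of_int N / (\<alpha> + \<beta> + 2)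
      else ((\<alpha> + 1) * of_int N * (\<alpha> + \<beta>)
              + of_nat n * (2 * of_int N - \<alpha> + \<beta>) * (\<alpha> + \<beta> + of_nat n + 1))
           / ((\<alpha> + \<beta> + 2 * of_nat n) * (\<alpha> + \<beta> + 2 * of_nat n + 2)))"

definition hahn_gamma :: "nat \<Rightarrow> complex \<Rightarrow> complex \<Rightarrow> int \<Rightarrow> complex" where
  "hahn_gamma n \<alpha> \<beta> N =
     of_nat n * (of_int N + 1 - of_nat n) * (\<alpha> + \<beta> + of_nat n) * (\<alpha> + of_nat n) * (\<beta> + of_nat n)
       * (\<alpha> + \<beta> + of_int N + of_nat n + 1)
     / ((\<alpha> + \<beta> + 2 * of_nat n - 1) * (\<alpha> + \<beta> + 2 * of_nat n)\<^sup>2 * (\<alpha> + \<beta> + 2 * of_nat n + 1))"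

text \<open>
  Since \<open>Gamma\<close> is \<open>0\<close> at its poles and division by \<open>0\<close> gives \<open>0\<close>, the poles of the two denominator
  factors correctly yield the value \<open>0\<close>; poles of the numerator factors have to be excluded where
  the weight is used.
\<close>

definition hahn_weight :: "complex \<Rightarrow> complex \<Rightarrow> int \<Rightarrow> complex \<Rightarrow> complex" where
  "hahn_weight \<alpha> \<beta> N x =
     (Gamma (\<beta> + of_int N + 1 - x) * Gamma (\<alpha> + 1 + x)) / (Gamma (1 + x) * Gamma (of_int N + 1 - x))"

definition hypergeo_1F1 :: "complex \<Rightarrow> complex \<Rightarrow> complex \<Rightarrow> complex" where
  "hypergeo_1F1 a b z = eval_fps (fps_hypergeo [a] [b] 1) z"

end

theory Submission
  imports Defs
begin

text \<open>
  Everything rests on the expansion of \<open>h\<^sub>n\<close> in the basis \<open>(- x)\<^sub>k\<close>. The forward difference lowers this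
  basis, which gives (ii). The operator of the difference equation, written as
  \<open>(\<alpha> + 1 + x) (N - x) \<Delta> f(x) - x (\<beta> + N + 1 - x) \<Delta> f(x - 1)\<close>, is bidiagonal in it, so (iii) is a
  two-term recursion for the coefficients. Combined with (ii) this operator
  expresses \<open>h\<^sub>n \<rho>\<close> as \<open>\<nabla>\<close> of the analogous product with shifted parameters, and iterating gives (iv).
  The recurrence (i) is compared coefficientwise, and (v) follows by rewriting the Cauchy product
  coefficient in the basis \<open>(- x)\<^sub>k\<close> with two applications of the Vandermonde identity.
\<close>

section \<open>Identities for rising factorials\<close>

text \<open>This is the Chu-Vandermonde identity with both sides reflected. The tail
  \<open>pochhammer (c + of_nat i) (m - i)\<close> replaces the quotient of
  \<open>pochhammer c m\<close> by \<open>pochhammer c i\<close> and keeps its meaning when that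
  quotient would be 0 / 0; the Hahn coefficients contain such tails.\<close>

lemma pochhammer_Vandermonde_shifted:
  fixes y c :: "'a :: field_char_0"
  shows "pochhammer (y + c) m =
    (\<Sum>i\<le>m. of_nat (m choose i) * ((- 1) ^ i * pochhammer (- y) i) * pochhammer (c + of_nat i) (m - i))"
proof -
  have eq: "pochhammer (1 - of_nat m - c) (m - i) = (- 1) ^ (m - i) * pochhammer (c + of_nat i) (m - i)"
    if "i \<le> m" for i
    using that pochhammer_minus[of "c + of_nat m - 1" "m - i"]
    by (simp add: of_nat_diff algebra_simps)
  have "pochhammer (y + c) m = (- 1) ^ m * pochhammer (- y + (1 - of_nat m - c)) m"
    using pochhammer_minus[of "y + c + of_nat m - 1" m] by (simp add: algebra_simps)
  also have "\<dots> = (- 1) ^ m * (\<Sum>i\<le>m. of_nat (m choose i) * pochhammer (- y) i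
      * pochhammer (1 - of_nat m - c) (m - i))"
    by (simp only: pochhammer_binomial_sum)
  also have "\<dots> = (\<Sum>i\<le>m. of_nat (m choose i) * ((- 1) ^ i * pochhammer (- y) i)
      * pochhammer (c + of_nat i) (m - i))"
    unfolding sum_distrib_left
  proof (intro sum.cong refl)
    fix i assume "i \<in> {..m}"
    hence i: "i \<le> m" by simp
    have "m + (m - i) = i + 2 * (m - i)"
      using i by simp
    hence sign: "(- 1 :: 'a) ^ m * (- 1) ^ (m - i) = (- 1) ^ i"
      by (simp only: power_add[symmetric]) (simp add: power_add)
    show "(- 1) ^ m * (of_nat (m choose i) * pochhammer (- y) i * pochhammer (1 - of_nat m - c) (m - i)) =
      of_nat (m choose i) * ((- 1) ^ i * pochhammer (- y) i) * pochhammer (c + of_nat i) (m - i)"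
      unfolding eq[OF i] sign[symmetric] by (simp only: mult_ac)
  qed
  finally show ?thesis .
qed

lemma pochhammer_minus_of_nat:
  "pochhammer (- of_nat n :: 'a :: field_char_0) k = (- 1) ^ k * fact k * of_nat (n choose k)"
  by (simp add: binomial_gbinomial gbinomial_pochhammer flip: power_mult_distrib)

text \<open>Both products contain \<open>pochhammer (- x) k\<close>; the remaining factors
  \<open>- (x + 1)\<close> and \<open>of_nat k - x\<close> differ by
  \<open>- of_nat (Suc k)\<close>.\<close>

lemma pochhammer_fwd_diff:
  fixes x :: "'a :: comm_ring_1"
  shows "pochhammer (- (x + 1)) (Suc k) - pochhammer (- x) (Suc k) = - of_nat (Suc k) * pochhammer (- x) k"
proof -
  have "pochhammer (- (x + 1)) (Suc k) = - (x + 1) * pochhammer (- x) k"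
    by (simp add: pochhammer_rec)
  thus ?thesis by (simp add: pochhammer_Suc[of "- x"] algebra_simps)
qed

subsection \<open>Differences\<close>

text \<open>The factor \<open>Suc k\<close> produced by differencing cancels in
  \<open>fact (Suc k)\<close>. Splitting off the first factors of the two Pochhammer symbols without
  \<open>x\<close> leaves exactly the coefficients of degree \<open>n\<close> for the shifted
  parameters.\<close>

lemma fwd_diff_hahn_cleared:
  "fwd_diff (hahn_cleared (Suc n) \<alpha> \<beta> N) x =
     of_nat (Suc n) * (\<alpha> + \<beta> + of_nat n + 2) * hahn_cleared n (\<alpha> + 1) (\<beta> + 1) (N - 1) x"
proof -
  define c where "c k = pochhammer (- of_nat (Suc n)) k * pochhammer (\<alpha> + \<beta> + of_nat (Suc n) + 1) k
            * pochhammer (- of_int N + of_nat k) (Suc n - k)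
            * pochhammer (\<alpha> + 1 + of_nat k) (Suc n - k) / fact k" for k
  have "fwd_diff (hahn_cleared (Suc n) \<alpha> \<beta> N) x =
    (\<Sum>k\<le>Suc n. c k * (pochhammer (- (x + 1)) k - pochhammer (- x) k))"
    unfolding fwd_diff_def hahn_cleared_def c_def
    by (simp only: sum_subtractf[symmetric]) (intro sum.cong refl, simp add: algebra_simps diff_divide_distrib)
  \<comment> \<open>The term of index 0 is constant in \<open>x\<close> and drops out.\<close>
  also have "\<dots> = (\<Sum>k\<le>n. c (Suc k) * (- of_nat (Suc k) * pochhammer (- x) k))"
    by (subst sum.atMost_Suc_shift) (simp only: pochhammer_fwd_diff, simp)
  also have "\<dots> = of_nat (Suc n) * (\<alpha> + \<beta> + of_nat n + 2) * hahn_cleared n (\<alpha> + 1) (\<beta> + 1) (N - 1) x"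
    unfolding hahn_cleared_def sum_distrib_left
  proof (intro sum.cong refl)
    fix k
    have 1: "pochhammer (- of_nat (Suc n) :: complex) (Suc k) = - of_nat (Suc n) * pochhammer (- of_nat n) k"
      by (simp add: pochhammer_rec)
    have 2: "pochhammer (\<alpha> + \<beta> + of_nat (Suc n) + 1) (Suc k) =
      (\<alpha> + \<beta> + of_nat n + 2) * pochhammer (\<alpha> + 1 + (\<beta> + 1) + of_nat n + 1) k"
      by (simp add: pochhammer_rec algebra_simps)
    have 3: "- of_int (N - 1) + of_nat k = (- of_int N + of_nat (Suc k) :: complex)"
      "\<alpha> + 1 + 1 + of_nat k = \<alpha> + 1 + of_nat (Suc k)" by simp_all
    show "c (Suc k) * (- of_nat (Suc k) * pochhammer (- x) k) =
      of_nat (Suc n) * (\<alpha> + \<beta> + of_nat n + 2) * (pochhammer (- of_nat n) k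
        * pochhammer (\<alpha> + 1 + (\<beta> + 1) + of_nat n + 1) k * pochhammer (- x) k
        * pochhammer (- of_int (N - 1) + of_nat k) (n - k) * pochhammer (\<alpha> + 1 + 1 + of_nat k) (n - k) / fact k)"
      unfolding c_def 1 2 3 diff_Suc_Suc fact_Suc of_nat_mult
      by (simp del: of_nat_Suc add: field_simps)
  qed
  finally show ?thesis .
qed

text \<open>The first factor is the one that differencing produces in
  \<open>fwd_diff_hahn_cleared\<close>, so it cancels in the monic version.\<close>

lemma hahn_denominator_Suc:
  fixes \<alpha> \<beta> :: complex
  shows "pochhammer (\<alpha> + \<beta> + of_nat (Suc n) + 1) (Suc n) =
      (\<alpha> + \<beta> + of_nat n + 2) * pochhammer (\<alpha> + 1 + (\<beta> + 1) + of_nat n + 1) n"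
  by (simp add: pochhammer_rec algebra_simps)

lemma hahn_existsD: "hahn_exists (Suc n) \<alpha> \<beta> \<Longrightarrow> \<alpha> + \<beta> + of_nat n + 2 \<noteq> 0"
  "hahn_exists (Suc n) \<alpha> \<beta> \<Longrightarrow> hahn_exists n (\<alpha> + 1) (\<beta> + 1)"
  unfolding hahn_exists_def hahn_denominator_Suc by auto

lemma fwd_diff_hahn:
  assumes "hahn_exists (Suc n) \<alpha> \<beta>"
  shows "fwd_diff (hahn (int (Suc n)) \<alpha> \<beta> N) x = of_nat (Suc n) * hahn (int n) (\<alpha> + 1) (\<beta> + 1) (N - 1) x"
proof -
  have "fwd_diff (hahn (int (Suc n)) \<alpha> \<beta> N) x =
    fwd_diff (hahn_cleared (Suc n) \<alpha> \<beta> N) x / pochhammer (\<alpha> + \<beta> + of_nat (Suc n) + 1) (Suc n)"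
    by (simp add: fwd_diff_def hahn_def diff_divide_distrib nat_add_distrib)
  also have "\<dots> = of_nat (Suc n) * hahn (int n) (\<alpha> + 1) (\<beta> + 1) (N - 1) x"
    unfolding hahn_denominator_Suc fwd_diff_hahn_cleared using hahn_existsD(1)[OF assms]
    by (simp add: hahn_def)
  finally show ?thesis .
qed

lemma funpow_fwd_diff_scale: "(fwd_diff ^^ k) (\<lambda>x. c * f x) = (\<lambda>x. c * (fwd_diff ^^ k) f x)"
  by (induction k) (auto simp: fwd_diff_def fun_eq_iff algebra_simps)

text \<open>The backward difference is the forward one followed by a translation, and translations
  commute with differences.\<close>

lemma funpow_bwd_diff_eq: "(bwd_diff ^^ k) f x = (fwd_diff ^^ k) f (x - of_nat k)"
  by (induction k arbitrary: x) (auto simp: fwd_diff_def bwd_diff_def algebra_simps)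

text \<open>The induction removes the innermost difference, which changes degree, parameters and
  \<open>N\<close> together; hence all of them are generalised.\<close>

lemma funpow_fwd_diff_hahn:
  assumes "hahn_exists n \<alpha> \<beta>" "k \<le> n"
  shows "(fwd_diff ^^ k) (hahn (int n) \<alpha> \<beta> N) x =
    pochhammer (of_nat n - of_nat k + 1) k * hahn (int n - int k) (\<alpha> + of_nat k) (\<beta> + of_nat k) (N - int k) x"
  using assms
proof (induction k arbitrary: n \<alpha> \<beta> N)
  case (Suc k)
  then obtain m where n: "n = Suc m" by (cases n) auto
  have "(fwd_diff ^^ Suc k) (hahn (int n) \<alpha> \<beta> N) x = (fwd_diff ^^ k) (fwd_diff (hahn (int n) \<alpha> \<beta> N)) x"
    by (simp add: funpow_swap1)
  also have "fwd_diff (hahn (int n) \<alpha> \<beta> N) = (\<lambda>x. of_nat n * hahn (int m) (\<alpha> + 1) (\<beta> + 1) (N - 1) x)"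
    using fwd_diff_hahn Suc.prems unfolding n by blast
  also have "(fwd_diff ^^ k) \<dots> x = of_nat n * (pochhammer (of_nat m - of_nat k + 1) k *
      hahn (int m - int k) (\<alpha> + 1 + of_nat k) (\<beta> + 1 + of_nat k) (N - 1 - int k) x)"
    using Suc.IH[of m "\<alpha> + 1" "\<beta> + 1" "N - 1"] Suc.prems hahn_existsD(2)
    unfolding funpow_fwd_diff_scale n by simp
  \<comment> \<open>The factor \<open>n\<close> is the last factor of the longer rising factorial,
    which starts at the same point \<open>m - k + 1\<close>.\<close>
  finally show ?case by (simp add: n pochhammer_Suc algebra_simps)
qed simp

subsection \<open>Difference equation\<close>

text \<open>Both differences are \<open>pochhammer (- x) k\<close> times a polynomial in
  \<open>x\<close>. The quadratic terms cancel, and the linear rest is a combination of 1 and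
  \<open>of_nat k - x\<close>, that is, of two consecutive basis elements.\<close>

lemma hahn_difference_operator_basis:
  fixes \<alpha> \<beta> M x :: complex
  defines "L \<equiv> \<lambda>f. (\<alpha> + 1 + x) * (M - x) * (f (x + 1) - f x) - x * (\<beta> + M + 1 - x) * (f x - f (x - 1))"
  shows "L (\<lambda>x. pochhammer (- x) (Suc k)) =
    - (of_nat (Suc k) * (\<alpha> + \<beta> + of_nat k + 2)) * pochhammer (- x) (Suc k)
    + of_nat (Suc k) * (of_nat k - M) * (\<alpha> + 1 + of_nat k) * pochhammer (- x) k"
proof -
  have 1: "pochhammer (- x) (Suc k) = pochhammer (- x) k * (of_nat k - x)"
    by (simp add: pochhammer_Suc)
  have 2: "pochhammer (- (x + 1)) (Suc k) - pochhammer (- x) (Suc k) = - of_nat (Suc k) * pochhammer (- x) k"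
    by (rule pochhammer_fwd_diff)
  have "pochhammer (- x) (Suc k) - pochhammer (- (x - 1)) (Suc k) = - of_nat (Suc k) * pochhammer (1 - x) k"
    using pochhammer_fwd_diff[of "x - 1" k] by (simp del: of_nat_Suc)
  \<comment> \<open>The factor \<open>x\<close> of the operator completes
    \<open>pochhammer (1 - x) k\<close> to a basis element, up to sign.\<close>
  hence "x * (pochhammer (- x) (Suc k) - pochhammer (- (x - 1)) (Suc k)) =
      - of_nat (Suc k) * (x * pochhammer (1 - x) k)"
    by (simp only: mult_ac)
  also have "\<dots> = of_nat (Suc k) * pochhammer (- x) (Suc k)"
    by (simp add: pochhammer_rec add.commute del: of_nat_Suc)
  finally have 3: "x * (pochhammer (- x) (Suc k) - pochhammer (- (x - 1)) (Suc k)) =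
    of_nat (Suc k) * pochhammer (- x) k * (of_nat k - x)" unfolding 1 by simp
  have "L (\<lambda>x. pochhammer (- x) (Suc k)) = (\<alpha> + 1 + x) * (M - x) * (- of_nat (Suc k) * pochhammer (- x) k)
     - (\<beta> + M + 1 - x) * (of_nat (Suc k) * pochhammer (- x) k * (of_nat k - x))"
    unfolding L_def 2 3[symmetric] by (simp only: mult_ac)
  also have "\<dots> = - (of_nat (Suc k) * (\<alpha> + \<beta> + of_nat k + 2)) * pochhammer (- x) (Suc k)
    + of_nat (Suc k) * (of_nat k - M) * (\<alpha> + 1 + of_nat k) * pochhammer (- x) k"
    unfolding 1 by (simp only: of_nat_Suc) algebra
  finally show ?thesis .
qed

text \<open>Being an eigenfunction with eigenvalue \<open>- l n\<close> amounts to the recursion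
  \<open>step\<close> for the coefficients, which is the term ratio of the hypergeometric
  sum.\<close>

lemma hahn_cleared_difference_equation:
  fixes n :: nat and \<alpha> \<beta> x :: complex and N :: int
  defines "h \<equiv> hahn_cleared n \<alpha> \<beta> N"
  shows "(\<alpha> + 1 + x) * (of_int N - x) * (h (x + 1) - h x) - x * (\<beta> + of_int N + 1 - x) * (h x - h (x - 1))
     + of_nat n * (of_nat n + \<alpha> + \<beta> + 1) * h x = 0"
proof -
  define M :: complex where "M = of_int N"
  define a where "a k = pochhammer (- of_nat n) k * pochhammer (\<alpha> + \<beta> + of_nat n + 1) k
            * pochhammer (- M + of_nat k) (n - k)
            * pochhammer (\<alpha> + 1 + of_nat k) (n - k) / fact k" for k
  define p where "p k x = pochhammer (- x) k" for k and x :: complex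
  define l where "l k = of_nat k * (of_nat k + \<alpha> + \<beta> + 1)" for k :: nat
  define L where "L f = (\<alpha> + 1 + x) * (M - x) * (f (x + 1) - f x) - x * (\<beta> + M + 1 - x) * (f x - f (x - 1))"
    for f :: "complex \<Rightarrow> complex"
  \<comment> \<open>The part of the image that lies one basis element lower. It is 0 at index 0,
    since differences annihilate constants.\<close>
  define c where "c k = (case k of 0 \<Rightarrow> 0
    | Suc k \<Rightarrow> of_nat (Suc k) * (of_nat k - M) * (\<alpha> + 1 + of_nat k) * p k x)" for k
  have h: "h = (\<lambda>x. \<Sum>k\<le>n. a k * p k x)"
    unfolding h_def hahn_cleared_def a_def p_def M_def fun_eq_iff by (intro allI sum.cong refl) simp
  have Lp: "L (p k) = - l k * p k x + c k" for k
  proof (cases k)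
    case (Suc k)
    have "L (\<lambda>x. pochhammer (- x) (Suc k)) =
      - (of_nat (Suc k) * (\<alpha> + \<beta> + of_nat k + 2)) * pochhammer (- x) (Suc k)
      + of_nat (Suc k) * (of_nat k - M) * (\<alpha> + 1 + of_nat k) * pochhammer (- x) k"
      unfolding L_def by (rule hahn_difference_operator_basis)
    thus ?thesis unfolding Suc c_def p_def l_def by (simp add: algebra_simps)
  qed (simp add: L_def p_def l_def c_def)
  have step: "a (Suc k) * c (Suc k) = a k * (l k - l n) * p k x" if "k < n" for k
  proof -
    have nk: "n - k = Suc (n - Suc k)" using that by simp
    have 1: "pochhammer (- M + of_nat k) (n - k) = (of_nat k - M) * pochhammer (- M + of_nat (Suc k)) (n - Suc k)"
      "pochhammer (\<alpha> + 1 + of_nat k) (n - k) = (\<alpha> + 1 + of_nat k) * pochhammer (\<alpha> + 1 + of_nat (Suc k)) (n - Suc k)"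
      unfolding nk by (simp_all add: pochhammer_rec algebra_simps)
    \<comment> \<open>The two factors are those by which the numerator Pochhammer symbols grow from
      \<open>k\<close> to \<open>Suc k\<close>.\<close>
    have 2: "l k - l n = (- of_nat n + of_nat k) * (\<alpha> + \<beta> + of_nat n + 1 + of_nat k)"
      unfolding l_def by algebra
    show ?thesis unfolding a_def 1 2 c_def pochhammer_Suc fact_Suc of_nat_mult nat.case
      by (simp del: of_nat_Suc)
  qed
  have "L h = (\<Sum>k\<le>n. a k * L (p k))"
    unfolding L_def h
    by (simp add: sum_distrib_left sum_subtractf[symmetric] algebra_simps sum.distrib[symmetric])
  also have "\<dots> = (\<Sum>k\<le>n. a k * c k) - (\<Sum>k\<le>n. a k * l k * p k x)"
    unfolding Lp sum_subtractf[symmetric] by (intro sum.cong refl) (simp add: algebra_simps)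
  also have "(\<Sum>k\<le>n. a k * c k) = (\<Sum>k<n. a (Suc k) * c (Suc k))"
    using sum.lessThan_Suc_shift[of "\<lambda>k. a k * c k" n] by (simp add: c_def lessThan_Suc_atMost)
  also have "\<dots> = (\<Sum>k<n. a k * (l k - l n) * p k x)"
    by (intro sum.cong refl step) auto
  \<comment> \<open>The added term of index \<open>n\<close> contains
    \<open>l n - l n\<close>.\<close>
  also have "\<dots> = (\<Sum>k\<le>n. a k * (l k - l n) * p k x)"
    by (simp flip: lessThan_Suc_atMost)
  also have "\<dots> - (\<Sum>k\<le>n. a k * l k * p k x) = - l n * h x"
    unfolding h sum_subtractf[symmetric] sum_distrib_left by (intro sum.cong refl) (simp add: algebra_simps)
  finally show ?thesis unfolding L_def l_def M_def by (simp add: algebra_simps)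
qed

subsection \<open>Rodrigues formula\<close>

text \<open>Since \<open>rGamma\<close> is entire, its functional equation holds everywhere; only
  the poles of the two numerator factors then restrict the shift rules.\<close>

lemma hahn_weight_rGamma:
  "hahn_weight \<alpha> \<beta> N x =
     Gamma (\<beta> + of_int N + 1 - x) * Gamma (\<alpha> + 1 + x) * rGamma (1 + x) * rGamma (of_int N + 1 - x)"
  by (simp add: hahn_weight_def rGamma_inverse_Gamma field_simps)

text \<open>The sum \<beta> + N is preserved, so one numerator factor does not change. The
  multiplier is the coefficient of the difference at \<open>x\<close> in the difference
  operator.\<close>

lemma hahn_weight_shift:
  assumes "\<alpha> + 1 + x \<notin> \<int>\<^sub>\<le>\<^sub>0"
  shows "hahn_weight (\<alpha> + 1) (\<beta> + 1) (N - 1) x = (\<alpha> + 1 + x) * (of_int N - x) * hahn_weight \<alpha> \<beta> N x"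
proof -
  have 1: "Gamma (\<alpha> + 1 + 1 + x) = (\<alpha> + 1 + x) * Gamma (\<alpha> + 1 + x)"
    using Gamma_plus1[OF assms] by (simp add: add_ac)
  have 2: "rGamma (of_int (N - 1) + 1 - x) = (of_int N - x) * rGamma (of_int N + 1 - x)"
    using rGamma_plus1[of "of_int N - x"] by (simp add: algebra_simps)
  show ?thesis unfolding hahn_weight_rGamma 1 2 by (simp add: mult_ac)
qed

text \<open>Here it is \<alpha> + x and N - x that are preserved. The multiplier is the coefficient
  of the difference at \<open>x - 1\<close>, up to sign.\<close>

lemma hahn_weight_shift':
  assumes "\<beta> + of_int N + 1 - x \<notin> \<int>\<^sub>\<le>\<^sub>0"
  shows "hahn_weight (\<alpha> + 1) (\<beta> + 1) (N - 1) (x - 1) = x * (\<beta> + of_int N + 1 - x) * hahn_weight \<alpha> \<beta> N x"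
proof -
  have 1: "Gamma (\<beta> + 1 + of_int (N - 1) + 1 - (x - 1)) = (\<beta> + of_int N + 1 - x) * Gamma (\<beta> + of_int N + 1 - x)"
    using Gamma_plus1[OF assms] by (simp add: algebra_simps)
  have 2: "rGamma (1 + (x - 1)) = x * rGamma (1 + x)"
    using rGamma_plus1[of x] by (simp add: add_ac)
  have 3: "\<alpha> + 1 + 1 + (x - 1) = \<alpha> + 1 + x" "of_int (N - 1) + 1 - (x - 1) = of_int N + 1 - x"
    by simp_all
  show ?thesis unfolding hahn_weight_rGamma 1 2 3 by (simp add: mult_ac)
qed

text \<open>In the difference equation both differences are \<open>l\<close> times a value of the
  lower polynomial, and \<open>l\<close> is also the eigenvalue. It is nonzero by
  \<open>hahn_existsD\<close> and can be divided out.\<close>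

lemma hahn_cleared_raising:
  fixes \<alpha> \<beta> x :: complex and N :: int
  assumes "hahn_exists (Suc n) \<alpha> \<beta>"
  defines "h \<equiv> hahn_cleared n (\<alpha> + 1) (\<beta> + 1) (N - 1)"
  shows "hahn_cleared (Suc n) \<alpha> \<beta> N x =
    x * (\<beta> + of_int N + 1 - x) * h (x - 1) - (\<alpha> + 1 + x) * (of_int N - x) * h x"
proof -
  define l where "l = of_nat (Suc n) * (\<alpha> + \<beta> + of_nat n + 2)"
  have "l \<noteq> 0" unfolding l_def using hahn_existsD(1)[OF assms(1)] of_nat_neq_0 by simp
  have d: "hahn_cleared (Suc n) \<alpha> \<beta> N (y + 1) - hahn_cleared (Suc n) \<alpha> \<beta> N y = l * h y" for y
    using fwd_diff_hahn_cleared unfolding fwd_diff_def h_def l_def .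
  have l: "of_nat (Suc n) * (of_nat (Suc n) + \<alpha> + \<beta> + 1) = l" unfolding l_def by simp
  have "(\<alpha> + 1 + x) * (of_int N - x) * (l * h x) - x * (\<beta> + of_int N + 1 - x) * (l * h (x - 1))
     + l * hahn_cleared (Suc n) \<alpha> \<beta> N x = 0"
    using hahn_cleared_difference_equation[of \<alpha> x N "Suc n" \<beta>] d[of x] d[of "x - 1"] unfolding l by simp
  hence "l * hahn_cleared (Suc n) \<alpha> \<beta> N x =
    l * (x * (\<beta> + of_int N + 1 - x) * h (x - 1) - (\<alpha> + 1 + x) * (of_int N - x) * h x)"
    by (simp add: algebra_simps add_eq_0_iff2)
  thus ?thesis using \<open>l \<noteq> 0\<close> by simp
qed

lemma hahn_cleared_Rodrigues:
  assumes "hahn_exists n \<alpha> \<beta>" "\<beta> + of_int N + 1 - x \<notin> \<int>\<^sub>\<le>\<^sub>0" "\<alpha> + 1 + x \<notin> \<int>\<^sub>\<le>\<^sub>0"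
  shows "hahn_cleared n \<alpha> \<beta> N x * hahn_weight \<alpha> \<beta> N x =
    (- 1) ^ n * (bwd_diff ^^ n) (hahn_weight (\<alpha> + of_nat n) (\<beta> + of_nat n) (N - int n)) x"
  using assms
proof (induction n arbitrary: \<alpha> \<beta> N x)
  case 0
  show ?case by (simp add: hahn_cleared_def)
next
  case (Suc n)
  let ?h = "hahn_cleared n (\<alpha> + 1) (\<beta> + 1) (N - 1)" and ?\<rho> = "hahn_weight (\<alpha> + 1) (\<beta> + 1) (N - 1)"
  let ?D = "(bwd_diff ^^ n) (hahn_weight (\<alpha> + of_nat (Suc n)) (\<beta> + of_nat (Suc n)) (N - int (Suc n)))"
  have shift: "\<alpha> + 1 + of_nat n = \<alpha> + of_nat (Suc n)" "\<beta> + 1 + of_nat n = \<beta> + of_nat (Suc n)"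
    "N - 1 - int n = N - int (Suc n)" by simp_all
  \<comment> \<open>At \<open>x\<close> the argument with \<alpha> moves up by one, at
    \<open>x - 1\<close> the argument with \<beta> does; the other argument stays as it is.\<close>
  have up: "z + 1 \<notin> \<int>\<^sub>\<le>\<^sub>0" if "z \<notin> \<int>\<^sub>\<le>\<^sub>0" for z :: complex
    using that plus_one_in_nonpos_Ints_imp by blast
  have "?h x * ?\<rho> x = (- 1) ^ n * ?D x"
    unfolding shift[symmetric]
    using Suc.prems up[OF Suc.prems(3)] by (intro Suc.IH hahn_existsD(2)) (auto simp: algebra_simps)
  moreover have "?h (x - 1) * ?\<rho> (x - 1) = (- 1) ^ n * ?D (x - 1)"
    unfolding shift[symmetric]
    using Suc.prems up[OF Suc.prems(2)] by (intro Suc.IH hahn_existsD(2)) (auto simp: algebra_simps)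
  ultimately have "(- 1) ^ Suc n * bwd_diff ?D x = ?h (x - 1) * ?\<rho> (x - 1) - ?h x * ?\<rho> x"
    by (simp add: bwd_diff_def algebra_simps)
  \<comment> \<open>The two shift rules turn the difference of the products into the raising
    relation times the weight.\<close>
  also have "\<dots> = hahn_cleared (Suc n) \<alpha> \<beta> N x * hahn_weight \<alpha> \<beta> N x"
    unfolding hahn_cleared_raising[OF Suc.prems(1)] hahn_weight_shift[OF Suc.prems(3)]
      hahn_weight_shift'[OF Suc.prems(2)] by (simp add: algebra_simps)
  finally show ?case by simp
qed

subsection \<open>Generating function\<close>

text \<open>Writing \<open>x - M\<close> as \<open>(x - k) + (k - M)\<close> makes Vandermonde
  produce factors \<open>pochhammer (- x + of_nat k) i\<close>, which extend
  \<open>pochhammer (- x) k\<close> to a longer basis element.\<close>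

lemma pochhammer_Newton:
  fixes x M :: "'a :: field_char_0"
  shows "pochhammer (- x) k * pochhammer (x - M) m =
    (\<Sum>i\<le>m. of_nat (m choose i) * (- 1) ^ i * pochhammer (- x) (k + i)
      * pochhammer (- M + of_nat (k + i)) (m - i))"
proof -
  have "pochhammer (x - M) m = pochhammer ((x - of_nat k) + (- M + of_nat k)) m" by simp
  also have "\<dots> = (\<Sum>i\<le>m. of_nat (m choose i) * ((- 1) ^ i * pochhammer (- x + of_nat k) i)
      * pochhammer (- M + of_nat (k + i)) (m - i))"
    unfolding pochhammer_Vandermonde_shifted[of "x - of_nat k" "- M + of_nat k" m] by (simp add: algebra_simps)
  finally have expand: "pochhammer (x - M) m = \<dots>" .
  show ?thesis
    unfolding expand pochhammer_product'[of "- x"] sum_distrib_left by (intro sum.cong refl) (simp only: mult_ac)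
qed

text \<open>The sum is the Cauchy product coefficient of the two confluent series, with the
  denominators multiplied out so that it is polynomial in the parameters.\<close>

lemma hahn_cleared_Cauchy_product:
  "hahn_cleared n \<alpha> \<beta> N x =
    (\<Sum>k\<le>n. of_nat (n choose k) * (- 1) ^ k * pochhammer (- x) k * pochhammer (x - of_int N) (n - k)
      * pochhammer (\<alpha> + 1 + of_nat k) (n - k) * pochhammer (\<beta> + 1 + of_nat (n - k)) k)"
proof -
  define M :: complex where "M = of_int N"
  define u where "u k = pochhammer (\<alpha> + 1 + of_nat k) (n - k) * pochhammer (\<beta> + 1 + of_nat (n - k)) k" for k
  define v where "v l = (- 1) ^ l * pochhammer (- x) l * pochhammer (- M + of_nat l) (n - l)" for l
  have "(\<Sum>k\<le>n. of_nat (n choose k) * (- 1) ^ k * pochhammer (- x) k * pochhammer (x - M) (n - k)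
      * pochhammer (\<alpha> + 1 + of_nat k) (n - k) * pochhammer (\<beta> + 1 + of_nat (n - k)) k)
    = (\<Sum>k\<le>n. of_nat (n choose k) * (- 1) ^ k * u k * (pochhammer (- x) k * pochhammer (x - M) (n - k)))"
    by (simp add: u_def mult_ac)
  also have "\<dots> = (\<Sum>k\<le>n. \<Sum>i\<le>n - k. of_nat ((n choose k) * (n - k choose i)) * u k * v (k + i))"
    unfolding pochhammer_Newton sum_distrib_left
    by (intro sum.cong refl) (simp add: v_def power_add mult_ac)
  \<comment> \<open>Terms are collected by \<open>l = k + i\<close>; then the triangular double sum
    is exchanged to isolate the coefficient of \<open>v l\<close>.\<close>
  also have "\<dots> = (\<Sum>k\<le>n. \<Sum>l=k..n. of_nat ((n choose k) * (n - k choose (l - k))) * u k * v l)"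
  proof (rule sum.cong[OF refl])
    fix k assume "k \<in> {..n}"
    hence k: "k \<le> n" by simp
    show "(\<Sum>i\<le>n - k. of_nat ((n choose k) * (n - k choose i)) * u k * v (k + i)) =
      (\<Sum>l=k..n. of_nat ((n choose k) * (n - k choose (l - k))) * u k * v l)"
      by (rule sum.reindex_bij_witness[of _ "\<lambda>l. l - k" "\<lambda>i. k + i"]) (use k in auto)
  qed
  also have "\<dots> = (\<Sum>l\<le>n. \<Sum>k\<le>l. of_nat ((n choose k) * (n - k choose (l - k))) * u k * v l)"
  proof -
    let ?g = "\<lambda>k l. of_nat ((n choose k) * (n - k choose (l - k))) * u k * v l"
    have "(\<Sum>k\<le>n. \<Sum>l=k..n. ?g k l) = (\<Sum>k\<le>n. \<Sum>l\<in>{l \<in> {..n}. k \<le> l}. ?g k l)"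
      by (intro sum.cong refl) auto
    also have "\<dots> = (\<Sum>l\<le>n. \<Sum>k\<in>{k \<in> {..n}. k \<le> l}. ?g k l)"
      by (rule sum.swap_restrict) simp_all
    also have "\<dots> = (\<Sum>l\<le>n. \<Sum>k\<le>l. ?g k l)"
      by (intro sum.cong refl) auto
    finally show ?thesis .
  qed
  also have "\<dots> = hahn_cleared n \<alpha> \<beta> N x"
    unfolding hahn_cleared_def
  proof (intro sum.cong refl)
    fix l assume "l \<in> {..n}"
    hence l: "l \<le> n" by simp
    \<comment> \<open>Everything depending only on \<open>l\<close> is split off, and the \<beta>
      factor is reversed. The rest is the Vandermonde summand for \<beta> + n and \<alpha> +
      1.\<close>
    have uk: "of_nat ((n choose k) * (n - k choose (l - k))) * u k =
      of_nat (n choose l) * pochhammer (\<alpha> + 1 + of_nat l) (n - l) *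
      (of_nat (l choose k) * ((- 1) ^ k * pochhammer (- (\<beta> + of_nat n)) k) * pochhammer (\<alpha> + 1 + of_nat k) (l - k))"
      if "k \<le> l" for k
    proof -
      have 1: "(n choose k) * (n - k choose (l - k)) = (n choose l) * (l choose k)"
        using choose_mult[OF that l] by simp
      have 2: "pochhammer (\<alpha> + 1 + of_nat k) (n - k) =
        pochhammer (\<alpha> + 1 + of_nat k) (l - k) * pochhammer (\<alpha> + 1 + of_nat l) (n - l)"
        using pochhammer_product[of "l - k" "n - k" "\<alpha> + 1 + of_nat k"] that l
        by (simp add: of_nat_diff add.assoc)
      have 3: "pochhammer (\<beta> + 1 + of_nat (n - k)) k = (- 1) ^ k * pochhammer (- (\<beta> + of_nat n)) k"
      proof -
        have "\<beta> + of_nat n - of_nat k + 1 = \<beta> + 1 + of_nat (n - k)"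
          using that l by (simp add: of_nat_diff)
        thus ?thesis
          by (simp only: pochhammer_minus mult.assoc[symmetric] power_mult_distrib[symmetric]) simp
      qed
      show ?thesis unfolding 1 u_def 2 3 of_nat_mult by (simp add: mult_ac)
    qed
    have "(\<Sum>k\<le>l. of_nat ((n choose k) * (n - k choose (l - k))) * u k * v l) =
      of_nat (n choose l) * pochhammer (\<alpha> + 1 + of_nat l) (n - l) *
      pochhammer ((\<beta> + of_nat n) + (\<alpha> + 1)) l * v l"
      unfolding pochhammer_Vandermonde_shifted[of "\<beta> + of_nat n" "\<alpha> + 1" l] sum_distrib_left sum_distrib_right
      by (intro sum.cong refl) (simp only: uk atMost_iff)
    also have "\<dots> = pochhammer (- of_nat n) l * pochhammer (\<alpha> + \<beta> + of_nat n + 1) l * pochhammer (- x) l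
            * pochhammer (- of_int N + of_nat l) (n - l) * pochhammer (\<alpha> + 1 + of_nat l) (n - l) / fact l"
      by (simp add: v_def M_def pochhammer_minus_of_nat add_ac)
    finally show "(\<Sum>k\<le>l. of_nat ((n choose k) * (n - k choose (l - k))) * u k * v l) = \<dots>" .
  qed
  finally show ?thesis by (simp add: M_def)
qed

text \<open>The term ratio tends to 0 for every \<open>z\<close>, so the ratio test gives absolute
  convergence.\<close>

lemma summable_hypergeo_1F1:
  fixes a b z :: complex
  assumes "b \<notin> \<int>\<^sub>\<le>\<^sub>0"
  shows "summable (\<lambda>n. norm (pochhammer a n / (pochhammer b n * fact n) * z ^ n))"
proof -
  define f where "f n = pochhammer a n / (pochhammer b n * fact n) * z ^ n" for n
  have "b + of_nat n \<noteq> 0" for n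
    using assms by (metis add_eq_0_iff2 minus_of_nat_in_nonpos_Ints)
  hence quot: "(a + of_nat n) / (b + of_nat n) = 1 + (a - b) / (b + of_nat n)" for n
    by (auto simp: divide_simps)
  have inf: "filterlim (\<lambda>n. c + of_nat n) at_infinity sequentially" for c :: complex
    by (rule tendsto_add_filterlim_at_infinity[OF tendsto_const tendsto_of_nat])
  have "(\<lambda>n. (a + of_nat n) / (b + of_nat n) * (z / (1 + of_nat n))) \<longlonglongrightarrow> (1 + 0) * 0"
    unfolding quot 
    by (rule tendsto_mult[OF tendsto_add[OF tendsto_const tendsto_divide_0[OF tendsto_const inf]]
      tendsto_divide_0[OF tendsto_const inf]])
  hence "(\<lambda>n. (a + of_nat n) / (b + of_nat n) * (z / of_nat (Suc n))) \<longlonglongrightarrow> 0"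
    by simp
  hence "eventually (\<lambda>n. norm ((a + of_nat n) / (b + of_nat n) * (z / of_nat (Suc n))) < 1/2) sequentially"
    by (rule order_tendstoD(2)[OF tendsto_norm_zero]) simp
  then obtain n0 where n0: "\<And>n. n \<ge> n0 \<Longrightarrow> norm ((a + of_nat n) / (b + of_nat n) * (z / of_nat (Suc n))) < 1/2"
    by (auto simp: eventually_sequentially)
  have rec: "f (Suc n) = (a + of_nat n) / (b + of_nat n) * (z / of_nat (Suc n)) * f n" for n
    unfolding f_def by (simp add: pochhammer_Suc divide_simps del: of_nat_Suc)
  have "summable (\<lambda>n. norm (f n))"
  proof (rule summable_ratio_test[of "1/2" n0])
    fix n assume "n \<ge> n0"
    hence "norm (f (Suc n)) \<le> 1/2 * norm (f n)"
      unfolding rec norm_mult[of _ "f n"] using n0[of n] by (intro mult_right_mono) auto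
    thus "norm (norm (f (Suc n))) \<le> 1/2 * norm (norm (f n))" by simp
  qed simp
  thus ?thesis unfolding f_def .
qed

lemma hypergeo_1F1_eq: "hypergeo_1F1 a b z = (\<Sum>n. pochhammer a n / (pochhammer b n * fact n) * z ^ n)"
  by (simp add: hypergeo_1F1_def eval_fps_def)

text \<open>Both series converge absolutely, so their product is the Cauchy product, whose
  coefficients are given by \<open>hahn_cleared_Cauchy_product\<close>.\<close>

lemma hahn_cleared_generating_function:
  assumes "\<alpha> + 1 \<notin> \<int>\<^sub>\<le>\<^sub>0" "\<beta> + 1 \<notin> \<int>\<^sub>\<le>\<^sub>0"
  shows "(\<lambda>n. hahn_cleared n \<alpha> \<beta> N x / (pochhammer (\<beta> + 1) n * pochhammer (\<alpha> + 1) n * fact n) * t ^ n)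
    sums (hypergeo_1F1 (- x) (\<alpha> + 1) (- t) * hypergeo_1F1 (- of_int N + x) (\<beta> + 1) t)"
proof -
  have nz: "pochhammer b k \<noteq> 0" if "b \<notin> \<int>\<^sub>\<le>\<^sub>0" for b :: complex and k
    using that pochhammer_eq_0_imp_nonpos_Int by blast
  have "(\<Sum>k\<le>n. pochhammer (- x) k / (pochhammer (\<alpha> + 1) k * fact k) * (- t) ^ k *
      (pochhammer (- of_int N + x) (n - k) / (pochhammer (\<beta> + 1) (n - k) * fact (n - k)) * t ^ (n - k))) =
    hahn_cleared n \<alpha> \<beta> N x / (pochhammer (\<beta> + 1) n * pochhammer (\<alpha> + 1) n * fact n) * t ^ n" for n
    unfolding hahn_cleared_Cauchy_product sum_divide_distrib sum_distrib_right
  proof (intro sum.cong refl)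
    fix k assume "k \<in> {..n}"
    hence k: "k \<le> n" by simp
    have a: "pochhammer (\<alpha> + 1) n = pochhammer (\<alpha> + 1) k * pochhammer (\<alpha> + 1 + of_nat k) (n - k)"
      using pochhammer_product[OF k] .
    have b: "pochhammer (\<beta> + 1) n = pochhammer (\<beta> + 1) (n - k) * pochhammer (\<beta> + 1 + of_nat (n - k)) k"
      using pochhammer_product[of "n - k" n "\<beta> + 1"] k by simp
    have t: "(- t) ^ k * t ^ (n - k) = (- 1) ^ k * t ^ n"
      using k by (simp add: power_minus[of t] mult.assoc flip: power_add)
    have f: "of_nat (n choose k) = (fact n / (fact k * fact (n - k)) :: complex)"
      using binomial_fact[OF k] .
    have "pochhammer (\<alpha> + 1 + of_nat k) (n - k) \<noteq> 0" "pochhammer (\<beta> + 1 + of_nat (n - k)) k \<noteq> 0"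
      "pochhammer (\<alpha> + 1) k \<noteq> 0" "pochhammer (\<beta> + 1) (n - k) \<noteq> 0"
      using nz[OF assms(1), of n] nz[OF assms(2), of n] unfolding a b by auto
    moreover have "- of_int N + x = x - of_int N" by simp
    ultimately show "pochhammer (- x) k / (pochhammer (\<alpha> + 1) k * fact k) * (- t) ^ k *
      (pochhammer (- of_int N + x) (n - k) / (pochhammer (\<beta> + 1) (n - k) * fact (n - k)) * t ^ (n - k)) =
      of_nat (n choose k) * (- 1) ^ k * pochhammer (- x) k * pochhammer (x - of_int N) (n - k)
      * pochhammer (\<alpha> + 1 + of_nat k) (n - k) * pochhammer (\<beta> + 1 + of_nat (n - k)) k
      / (pochhammer (\<beta> + 1) n * pochhammer (\<alpha> + 1) n * fact n) * t ^ n"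
      unfolding a b f using t by (simp add: divide_simps)
  qed
  thus ?thesis
    using Cauchy_product_sums[OF summable_hypergeo_1F1[OF assms(1), of "- x" "- t"]
      summable_hypergeo_1F1[OF assms(2), of "- of_int N + x" t]]
    unfolding hypergeo_1F1_eq by simp
qed

subsection \<open>Three-term recurrence\<close>

text \<open>The comparison of coefficients after division by all common Pochhammer factors, with \<open>s = \<alpha> + \<beta>\<close>.\<close>

lemma hahn_recurrence_core:
  fixes n k j \<alpha> s N b q :: complex
  assumes "j = n - k" "q = s + 2 * n" "q \<noteq> 0" "q + 1 \<noteq> 0" "q + 2 \<noteq> 0" "j \<noteq> 0" "j + 1 \<noteq> 0"
    and "b = ((\<alpha> + 1) * N * s + n * (2 * N - 2 * \<alpha> + s) * (s + n + 1)) / (q * (q + 2))"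
  shows "k * (s + n + k) / j + k * (k - 1 - N) * (\<alpha> + k) / (j * (j + 1)) =
    (n + 1) * (n - N) * (\<alpha> + n + 1) * (s + n + k) * (s + n + k + 1) / ((j + 1) * j * (q + 1) * (q + 2))
    + b * (s + n + k) / j - (s + n) * (s - \<alpha> + n) * (s + N + n + 1) / (q * (q + 1))"
proof -
  define d where "d = j * (j + 1) * q * (q + 1) * (q + 2)"
  have "d \<noteq> 0" using assms(3-7) by (simp add: d_def)
  \<comment> \<open>Eliminating \<open>n\<close> and \<open>s\<close> turns the denominators into
    independent variables, so that a polynomial identity remains.\<close>
  have e: "n = j + k" "s = q - 2 * (j + k)" using assms(1,2) by simp_all
  have "d * (k * (s + n + k) / j + k * (k - 1 - N) * (\<alpha> + k) / (j * (j + 1))) =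
    k * (s + n + k) * ((j + 1) * q * (q + 1) * (q + 2)) + k * (k - 1 - N) * (\<alpha> + k) * (q * (q + 1) * (q + 2))"
    unfolding distrib_left[of d] using assms(3-7) by (simp add: d_def)
  also have "\<dots> = (n + 1) * (n - N) * (\<alpha> + n + 1) * (s + n + k) * (s + n + k + 1) * q
    + ((\<alpha> + 1) * N * s + n * (2 * N - 2 * \<alpha> + s) * (s + n + 1)) * (s + n + k) * ((j + 1) * (q + 1))
    - (s + n) * (s - \<alpha> + n) * (s + N + n + 1) * (j * (j + 1) * (q + 2))"
    unfolding e by algebra
  also have "\<dots> = d * ((n + 1) * (n - N) * (\<alpha> + n + 1) * (s + n + k) * (s + n + k + 1) / ((j + 1) * j * (q + 1) * (q + 2))
    + b * (s + n + k) / j - (s + n) * (s - \<alpha> + n) * (s + N + n + 1) / (q * (q + 1)))"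
    unfolding distrib_left[of d] right_diff_distrib[of d] assms(8) using assms(3-7) by (simp add: d_def)
  finally show ?thesis using \<open>d \<noteq> 0\<close> by simp
qed

text \<open>The coefficient of \<open>pochhammer (- x) k\<close> in the monic polynomial, with
  \<alpha> + \<beta> as \<open>s\<close>, after cancelling the common part of numerator and
  denominator. It is 0 for \<open>k > n\<close> through the binomial coefficient.\<close>

definition hahn_coeff :: "complex \<Rightarrow> complex \<Rightarrow> complex \<Rightarrow> nat \<Rightarrow> nat \<Rightarrow> complex" where
  "hahn_coeff \<alpha> s M n k = (- 1) ^ k * of_nat (n choose k) * pochhammer (- M + of_nat k) (n - k)
     * pochhammer (\<alpha> + 1 + of_nat k) (n - k) / pochhammer (s + of_nat n + of_nat k + 1) (n - k)"

text \<open>The larger bound \<open>m\<close> lets three consecutive degrees share one summation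
  range.\<close>

lemma hahn_expansion:
  assumes "hahn_exists n \<alpha> \<beta>" "n \<le> m"
  shows "hahn (int n) \<alpha> \<beta> N x = (\<Sum>k\<le>m. hahn_coeff \<alpha> (\<alpha> + \<beta>) (of_int N) n k * pochhammer (- x) k)"
proof -
  have "hahn (int n) \<alpha> \<beta> N x = (\<Sum>k\<le>n. hahn_coeff \<alpha> (\<alpha> + \<beta>) (of_int N) n k * pochhammer (- x) k)"
    unfolding hahn_def hahn_cleared_def
  proof (simp add: sum_divide_distrib, intro sum.cong refl)
    fix k assume "k \<in> {..n}"
    hence k: "k \<le> n" by simp
    have p: "pochhammer (\<alpha> + \<beta> + of_nat n + 1) n =
      pochhammer (\<alpha> + \<beta> + of_nat n + 1) k * pochhammer (\<alpha> + \<beta> + of_nat n + of_nat k + 1) (n - k)"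
      using pochhammer_product[OF k, of "\<alpha> + \<beta> + of_nat n + 1"] by (simp add: add_ac)
    hence "pochhammer (\<alpha> + \<beta> + of_nat n + 1) k \<noteq> 0"
      using assms(1) unfolding hahn_exists_def by auto
    thus "pochhammer (- of_nat n) k * pochhammer (\<alpha> + \<beta> + of_nat n + 1) k * pochhammer (- x) k
            * pochhammer (of_nat k - of_int N) (n - k)
            * pochhammer (\<alpha> + 1 + of_nat k) (n - k) / (fact k * pochhammer (\<alpha> + \<beta> + of_nat n + 1) n) =
         hahn_coeff \<alpha> (\<alpha> + \<beta>) (of_int N) n k * pochhammer (- x) k"
      by (simp add: p hahn_coeff_def pochhammer_minus_of_nat)
  qed
  also have "\<dots> = (\<Sum>k\<le>m. hahn_coeff \<alpha> (\<alpha> + \<beta>) (of_int N) n k * pochhammer (- x) k)"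
    using assms(2) by (intro sum.mono_neutral_left) (auto simp: hahn_coeff_def)
  finally show ?thesis .
qed

text \<open>The left side is the coefficient of \<open>pochhammer (- x) k\<close> in
  \<open>x\<close> times the polynomial; \<open>b\<close> and \<open>g\<close> are the recurrence
  coefficients with \<beta> written as \<open>s - \<alpha>\<close>. The nonvanishing range covers
  all denominators that occur.\<close>

lemma hahn_coeff_recurrence:
  fixes \<alpha> s M :: complex
  assumes n: "n \<ge> 1" and k: "k \<le> n + 1" and s: "\<And>j. n \<le> j \<Longrightarrow> j \<le> 2 * n + 2 \<Longrightarrow> s + of_nat j \<noteq> 0"
  defines "q \<equiv> s + 2 * of_nat n"
  defines "b \<equiv> ((\<alpha> + 1) * M * s + of_nat n * (2 * M - 2 * \<alpha> + s) * (s + of_nat n + 1)) / (q * (q + 2))"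
  defines "g \<equiv> - (of_nat n * (of_nat n - 1 - M) * (\<alpha> + of_nat n) * (s + of_nat n) * (s - \<alpha> + of_nat n)
    * (s + M + of_nat n + 1)) / ((q - 1) * q * (q * (q + 1)))"
  shows "of_nat k * hahn_coeff \<alpha> s M n k - (case k of 0 \<Rightarrow> 0 | Suc l \<Rightarrow> hahn_coeff \<alpha> s M n l) =
    hahn_coeff \<alpha> s M (n + 1) k + b * hahn_coeff \<alpha> s M n k + g * hahn_coeff \<alpha> s M (n - 1) k"
proof -
  have q: "q - 1 \<noteq> 0" "q \<noteq> 0" "q + 1 \<noteq> 0" "q + 2 \<noteq> 0"
    using s[of "2 * n - 1"] s[of "2 * n"] s[of "2 * n + 1"] s[of "2 * n + 2"] n
    by (simp_all add: q_def of_nat_diff algebra_simps)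
  \<comment> \<open>For the two top indices the lower polynomial contributes nothing; for all others
    the coefficients have a common factor.\<close>
  consider "k = n + 1" | "k = n" | i where "n = Suc (k + i)"
    using k less_imp_Suc_add[of k n] by fastforce
  thus ?thesis
  proof cases
    case 1
    thus ?thesis using n by (simp add: hahn_coeff_def binomial_eq_0)
  next
    case 2
    then obtain l where l: "n = Suc l" "k = Suc l" using n by (cases n) auto
    define m where "m = (of_nat n :: complex)"
    have m: "of_nat l = m - 1" by (simp add: m_def l)
    \<comment> \<open>The comparison at index \<open>n\<close> up to sign; this equation alone
      determines \<open>b\<close>.\<close>
    have "m + m * (m - 1 - M) * (\<alpha> + m) / q = (m + 1) * (m - M) * (\<alpha> + 1 + m) / (q + 2) + b"
    proof -
      have "q * (q + 2) * (m + m * (m - 1 - M) * (\<alpha> + m) / q) =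
        m * q * (q + 2) + m * (m - 1 - M) * (\<alpha> + m) * (q + 2)"
        using q by (simp add: divide_simps) (simp add: algebra_simps)
      also have "\<dots> = (m + 1) * (m - M) * (\<alpha> + 1 + m) * q
        + ((\<alpha> + 1) * M * s + m * (2 * M - 2 * \<alpha> + s) * (s + m + 1))"
        unfolding q_def m_def[symmetric] by algebra
      also have "\<dots> = q * (q + 2) * ((m + 1) * (m - M) * (\<alpha> + 1 + m) / (q + 2) + b)"
        unfolding b_def m_def[symmetric] distrib_left[of "q * (q + 2)"] using q by simp
      finally show ?thesis using q by simp
    qed
    hence main: "(- 1) ^ n * (m + m * (m - 1 - M) * (\<alpha> + m) / q) =
      (- 1) ^ n * ((m + 1) * (m - M) * (\<alpha> + 1 + m) / (q + 2) + b)" by simp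
    have c1: "hahn_coeff \<alpha> s M n l = - ((- 1) ^ n * (m * (m - 1 - M) * (\<alpha> + m) / q))"
    proof -
      have "s + of_nat n + of_nat l + 1 = q" "- M + of_nat l = m - 1 - M" "\<alpha> + 1 + of_nat l = \<alpha> + m"
        "n - l = Suc 0" "of_nat (n choose l) = m" "(- 1 :: complex) ^ n = - ((- 1) ^ l)"
        using m by (simp_all add: q_def m_def l)
      thus ?thesis unfolding hahn_coeff_def by simp
    qed
    have c2: "hahn_coeff \<alpha> s M (n + 1) n = (- 1) ^ n * ((m + 1) * (m - M) * (\<alpha> + 1 + m) / (q + 2))"
      unfolding hahn_coeff_def by (simp add: q_def m_def algebra_simps)
    have c3: "hahn_coeff \<alpha> s M n n = (- 1) ^ n" "hahn_coeff \<alpha> s M (n - 1) n = 0"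
      using n by (simp_all add: hahn_coeff_def)
    have c4: "(case k of 0 \<Rightarrow> 0 | Suc l \<Rightarrow> hahn_coeff \<alpha> s M n l) = hahn_coeff \<alpha> s M n l"
      by (simp add: l)
    show ?thesis
      unfolding c4 unfolding 2 m_def[symmetric] c1 c2 c3 using main by (simp add: algebra_simps)
  next
    case 3
    define m \<kappa> j where "m = (of_nat n :: complex)" and "\<kappa> = (of_nat k :: complex)" and "j = (of_nat (Suc i) :: complex)"
    have i: "of_nat i = m - \<kappa> - 1" and j: "j = m - \<kappa>" by (simp_all add: m_def \<kappa>_def j_def 3)
    have "j + 1 = of_nat (Suc (Suc i))" by (simp add: j_def)
    hence j0: "j \<noteq> 0" "j + 1 \<noteq> 0" unfolding j_def using of_nat_neq_0 by metis+
    define c where "c = (of_nat (k + i choose k) :: complex)"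
    define A where "A = pochhammer (- M + \<kappa>) i"
    define B where "B = pochhammer (\<alpha> + 1 + \<kappa>) i"
    define U where "U = s + m + \<kappa>"
    define E where "E = pochhammer U i"
    \<comment> \<open>\<open>w\<close> is the coefficient for \<open>n - 1\<close>; all four coefficients are \<open>w\<close> times a rational factor.\<close>
    define w where "w = (- 1) ^ k * c * A * B / E"
    \<comment> \<open>\<open>F\<close> is the further factor shared by all contributions: it occurs
      in the coefficients for \<open>n\<close> and \<open>n + 1\<close>, and in \<open>g\<close> for
      degree \<open>n - 1\<close>.\<close>
    define F where "F = m * (m - 1 - M) * (\<alpha> + m) / ((q - 1) * q)"
    have qU: "of_nat i = q - 1 - U" by (simp add: U_def q_def i flip: m_def)
    \<comment> \<open>By \<open>qU\<close> the factors following \<open>E\<close> are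
      \<open>q - 1\<close>, \<open>q\<close>, \<open>q + 1\<close> and \<open>q + 2\<close>.\<close>
    have E2: "pochhammer U (Suc (Suc i)) = E * ((q - 1) * q)"
      unfolding E_def pochhammer_Suc of_nat_Suc qU by (simp add: algebra_simps)
    have E4: "pochhammer U (Suc (Suc (Suc (Suc i)))) = E * ((q - 1) * q * (q + 1) * (q + 2))"
      unfolding E_def pochhammer_Suc of_nat_Suc qU by (simp add: algebra_simps)
    have "E \<noteq> 0"
    proof
      assume "E = 0"
      then obtain r where r: "r < i" "U = - of_nat r" unfolding E_def pochhammer_eq_0_iff by blast
      have "s + of_nat (n + k + r) = U + of_nat r" by (simp add: U_def m_def \<kappa>_def)
      thus False using s[of "n + k + r"] r 3 by simp
    qed
    have U: "U \<noteq> 0" "U + 1 \<noteq> 0"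
      using s[of "n + k"] s[of "n + k + 1"] 3 by (simp_all add: U_def m_def \<kappa>_def add_ac)
    \<comment> \<open>The denominators for degrees \<open>n\<close> and \<open>n + 1\<close> start
      at \<open>U + 1\<close> and \<open>U + 2\<close>; they are obtained from the longer products
      starting at \<open>U\<close>.\<close>
    have D1: "pochhammer (U + 1) (Suc i) = E * ((q - 1) * q) / U"
      using E2 U by (simp add: pochhammer_rec[of U] field_simps)
    have D2: "pochhammer (U + 2) (Suc (Suc i)) = E * ((q - 1) * q * (q + 1) * (q + 2)) / (U * (U + 1))"
    proof -
      have "pochhammer U (Suc (Suc (Suc (Suc i)))) = U * (U + 1) * pochhammer (U + 1 + 1) (Suc (Suc i))"
        unfolding pochhammer_rec[of U] pochhammer_rec[of "U + 1"] by (simp only: mult.assoc)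
      moreover have "U + 1 + 1 = U + 2" by simp
      ultimately show ?thesis using U unfolding E4 by simp
    qed
    have C1: "of_nat (n choose k) = m * c / j"
    proof -
      have "of_nat (Suc i * (n choose k)) = (of_nat (n * (k + i choose k)) :: complex)"
        using binomial_absorb_comp[of n k] 3 by simp
      hence "j * of_nat (n choose k) = m * c" by (simp only: of_nat_mult j_def m_def c_def)
      thus ?thesis using j0 by (simp add: eq_divide_eq mult_ac)
    qed
    have C2: "of_nat (n + 1 choose k) = (m + 1) * (m * c / j) / (j + 1)"
    proof -
      have "of_nat (Suc (Suc i) * (n + 1 choose k)) = (of_nat (Suc n * (n choose k)) :: complex)"
        using binomial_absorb_comp[of "n + 1" k] 3 by simp
      hence "(j + 1) * of_nat (n + 1 choose k) = (m + 1) * of_nat (n choose k)"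
        unfolding of_nat_mult by (simp add: j_def m_def add_ac del: binomial_Suc_Suc)
      thus ?thesis using j0 unfolding C1 by (simp add: eq_divide_eq mult_ac)
    qed
    have a0: "hahn_coeff \<alpha> s M (n - 1) k = w"
    proof -
      have "s + of_nat (k + i) + \<kappa> + 1 = U" by (simp add: U_def i \<kappa>_def)
      thus ?thesis unfolding hahn_coeff_def w_def c_def A_def B_def E_def \<kappa>_def by (simp add: 3)
    qed
    have a1: "hahn_coeff \<alpha> s M n k = w * F * (U / j)"
    proof -
      have "n - k = Suc i" by (simp add: 3)
      moreover have "pochhammer (- M + \<kappa>) (Suc i) = A * (m - 1 - M)"
        "pochhammer (\<alpha> + 1 + \<kappa>) (Suc i) = B * (\<alpha> + m)"
        unfolding pochhammer_Suc A_def B_def i by (simp_all add: algebra_simps)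
      ultimately show ?thesis
        unfolding hahn_coeff_def C1 m_def[symmetric] \<kappa>_def[symmetric] U_def[symmetric]
        by (simp add: D1 w_def F_def mult_ac)
    qed
    have a2: "hahn_coeff \<alpha> s M (n + 1) k =
      w * F * ((m + 1) * (m - M) * (\<alpha> + m + 1) * U * (U + 1) / ((j + 1) * j * (q + 1) * (q + 2)))"
    proof -
      have f1: "n + 1 - k = Suc (Suc i)" by (simp add: 3)
      have f2: "pochhammer (- M + \<kappa>) (Suc (Suc i)) = A * ((m - 1 - M) * (m - M))"
        "pochhammer (\<alpha> + 1 + \<kappa>) (Suc (Suc i)) = B * ((\<alpha> + m) * (\<alpha> + m + 1))"
        unfolding pochhammer_Suc A_def B_def of_nat_Suc i by (simp_all add: algebra_simps)
      have f3: "s + of_nat (n + 1) + \<kappa> + 1 = U + 2" by (simp add: U_def m_def)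
      show ?thesis
        unfolding hahn_coeff_def C2 \<kappa>_def[symmetric] f1 f2 f3 D2 w_def F_def by (simp add: mult_ac)
    qed
    \<comment> \<open>At \<open>k = 0\<close> the right side vanishes through its factor
      \<open>\<kappa>\<close>.\<close>
    have a3: "(case k of 0 \<Rightarrow> 0 | Suc l \<Rightarrow> hahn_coeff \<alpha> s M n l) =
      - (w * F * (\<kappa> * (\<kappa> - 1 - M) * (\<alpha> + \<kappa>) / (j * (j + 1))))"
    proof (cases k)
      case (Suc l)
      have nl: "n - l = Suc (Suc i)" by (simp add: 3 Suc)
      have "Suc (Suc i) * (n choose l) = k * (n choose k)"
        using binomial_absorb_comp[of n l] binomial_absorption[of l n] unfolding nl Suc by (simp only:)
      hence "of_nat (Suc (Suc i) * (n choose l)) = (of_nat (k * (n choose k)) :: complex)"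
        by (simp only:)
      hence "(j + 1) * of_nat (n choose l) = \<kappa> * of_nat (n choose k)"
        unfolding of_nat_mult by (simp add: j_def \<kappa>_def add_ac)
      hence C3: "of_nat (n choose l) = \<kappa> * (m * c / j) / (j + 1)"
        using j0 unfolding C1 by (simp add: eq_divide_eq mult_ac)
      have l: "of_nat l = \<kappa> - 1" by (simp add: \<kappa>_def Suc)
      have f1: "pochhammer (- M + (\<kappa> - 1)) (Suc (Suc i)) = (\<kappa> - 1 - M) * (A * (m - 1 - M))"
        unfolding pochhammer_rec[of "- M + (\<kappa> - 1)"] unfolding pochhammer_Suc A_def i by (simp add: algebra_simps)
      have f2: "pochhammer (\<alpha> + 1 + (\<kappa> - 1)) (Suc (Suc i)) = (\<alpha> + \<kappa>) * (B * (\<alpha> + m))"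
        unfolding pochhammer_rec[of "\<alpha> + 1 + (\<kappa> - 1)"] unfolding pochhammer_Suc B_def i by (simp add: algebra_simps)
      have f3: "s + m + (\<kappa> - 1) + 1 = U" by (simp add: U_def)
      have f4: "(- 1 :: complex) ^ l = - ((- 1) ^ k)" by (simp add: Suc)
      show ?thesis
        unfolding Suc nat.case hahn_coeff_def C3 l m_def[symmetric] nl f1 f2 f3 f4 E2 w_def F_def
        by (simp add: mult_ac)
    qed (simp add: \<kappa>_def)
    have g: "g = - F * ((s + m) * (s - \<alpha> + m) * (s + M + m + 1) / (q * (q + 1)))"
      unfolding g_def F_def m_def by (simp add: mult_ac)
    \<comment> \<open>With the rational functions hidden behind names, the goal is
      \<open>w * F\<close> times the core identity.\<close>
    define Q Y P R where "Q = U / j" and "Y = \<kappa> * (\<kappa> - 1 - M) * (\<alpha> + \<kappa>) / (j * (j + 1))"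
      and "P = (m + 1) * (m - M) * (\<alpha> + m + 1) * U * (U + 1) / ((j + 1) * j * (q + 1) * (q + 2))"
      and "R = (s + m) * (s - \<alpha> + m) * (s + M + m + 1) / (q * (q + 1))"
    have "\<kappa> * U / j + Y = P + b * U / j - R"
      unfolding Y_def P_def R_def U_def
      by (rule hahn_recurrence_core) (use j q j0 in \<open>simp_all add: q_def m_def b_def\<close>)
    hence "\<kappa> * Q + Y = P + b * Q - R" by (simp add: Q_def)
    thus ?thesis
      unfolding a0 a1 a2 a3 g \<kappa>_def[symmetric] Q_def[symmetric] Y_def[symmetric] P_def[symmetric] R_def[symmetric]
      by algebra
  qed
qed

text \<open>For positive \<open>n\<close> this is the coefficient recurrence summed over the basis.
  Degree 0 is computed directly, because there \<alpha> + \<beta> = 0 is permitted and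
  \<open>hahn_beta\<close> has its cancelled form.\<close>

lemma hahn_three_term_recurrence:
  assumes s: "\<And>j. 1 \<le> j \<Longrightarrow> n \<le> j \<Longrightarrow> j \<le> 2 * n + 2 \<Longrightarrow> \<alpha> + \<beta> \<noteq> - of_nat j"
  shows "x * hahn (int n) \<alpha> \<beta> N x = hahn (int n + 1) \<alpha> \<beta> N x
    + hahn_beta n \<alpha> \<beta> N * hahn (int n) \<alpha> \<beta> N x + hahn_gamma n \<alpha> \<beta> N * hahn (int n - 1) \<alpha> \<beta> N x"
proof (cases "n = 0")
  case True
  have "\<alpha> + \<beta> + 2 \<noteq> 0" using s[of 2] True by (simp add: add_eq_0_iff2)
  thus ?thesis using True
    by (simp add: hahn_def hahn_cleared_def hahn_beta_def hahn_gamma_def add_ac)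
       (simp add: divide_simps, simp add: algebra_simps)
next
  case False
  define M :: complex where "M = of_int N"
  define a where "a = hahn_coeff \<alpha> (\<alpha> + \<beta>) M"
  define p where "p k = pochhammer (- x) k" for k
  have s': "\<alpha> + \<beta> + of_nat j \<noteq> 0" if "n \<le> j" "j \<le> 2 * n + 2" for j
    using s[of j] that False by (simp add: add_eq_0_iff2)
  \<comment> \<open>A vanishing denominator would make \<alpha> + \<beta> equal to
    \<open>- of_nat (m + 1 + r)\<close>, which lies in the excluded range.\<close>
  have ex: "hahn_exists m \<alpha> \<beta>" if "n \<le> m + 1" "m \<le> n + 1" for m
    unfolding hahn_exists_def pochhammer_eq_0_iff
  proof safe
    fix r assume r: "r < m" "\<alpha> + \<beta> + of_nat m + 1 = - of_nat r"
    have "\<alpha> + \<beta> + of_nat (m + 1 + r) = (\<alpha> + \<beta> + of_nat m + 1) + of_nat r" by (simp add: add_ac)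
    thus False using s'[of "m + 1 + r"] r that by simp
  qed
  have h: "hahn (int m) \<alpha> \<beta> N x = (\<Sum>k\<le>n + 1. a m k * p k)" if "n \<le> m + 1" "m \<le> n + 1" for m
    unfolding a_def M_def p_def by (rule hahn_expansion[OF ex[OF that] that(2)])
  have xp: "x * p k = of_nat k * p k - p (Suc k)" for k
    by (simp add: p_def pochhammer_Suc algebra_simps)
  have b: "hahn_beta n \<alpha> \<beta> N = ((\<alpha> + 1) * M * (\<alpha> + \<beta>) + of_nat n * (2 * M - 2 * \<alpha> + (\<alpha> + \<beta>)) * (\<alpha> + \<beta> + of_nat n + 1))
     / ((\<alpha> + \<beta> + 2 * of_nat n) * (\<alpha> + \<beta> + 2 * of_nat n + 2))"
    using False by (simp add: hahn_beta_def M_def algebra_simps)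
  have g: "hahn_gamma n \<alpha> \<beta> N = - (of_nat n * (of_nat n - 1 - M) * (\<alpha> + of_nat n) * (\<alpha> + \<beta> + of_nat n)
     * (\<alpha> + \<beta> - \<alpha> + of_nat n) * (\<alpha> + \<beta> + M + of_nat n + 1))
     / ((\<alpha> + \<beta> + 2 * of_nat n - 1) * (\<alpha> + \<beta> + 2 * of_nat n) * ((\<alpha> + \<beta> + 2 * of_nat n) * (\<alpha> + \<beta> + 2 * of_nat n + 1)))"
    unfolding hahn_gamma_def M_def[symmetric]
    by (rule arg_cong2[of _ _ _ _ "(/)"]) algebra+
  have "x * hahn (int n) \<alpha> \<beta> N x = (\<Sum>k\<le>n + 1. of_nat k * a n k * p k) - (\<Sum>k\<le>n. a n k * p (Suc k))"
  proof -
    have "x * hahn (int n) \<alpha> \<beta> N x = (\<Sum>k\<le>n + 1. a n k * (x * p k))"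
      using h[of n] by (simp only: sum_distrib_left mult_ac)
    also have "\<dots> = (\<Sum>k\<le>n + 1. of_nat k * a n k * p k) - (\<Sum>k\<le>n + 1. a n k * p (Suc k))"
      unfolding sum_subtractf[symmetric] xp by (intro sum.cong refl) (simp add: right_diff_distrib mult_ac)
    also have "(\<Sum>k\<le>n + 1. a n k * p (Suc k)) = (\<Sum>k\<le>n. a n k * p (Suc k))"
      by (simp add: a_def hahn_coeff_def binomial_eq_0)
    finally show ?thesis .
  qed
  also have "(\<Sum>k\<le>n. a n k * p (Suc k)) = (\<Sum>k\<le>n + 1. (case k of 0 \<Rightarrow> 0 | Suc l \<Rightarrow> a n l) * p k)"
    using sum.atMost_Suc_shift[of "\<lambda>k. (case k of 0 \<Rightarrow> 0 | Suc l \<Rightarrow> a n l) * p k" n] by simp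
  also have "(\<Sum>k\<le>n + 1. of_nat k * a n k * p k) - \<dots> =
    (\<Sum>k\<le>n + 1. (a (n + 1) k + hahn_beta n \<alpha> \<beta> N * a n k + hahn_gamma n \<alpha> \<beta> N * a (n - 1) k) * p k)"
    unfolding sum_subtractf[symmetric]
  proof (intro sum.cong refl)
    fix k assume "k \<in> {..n + 1}"
    hence "of_nat k * a n k - (case k of 0 \<Rightarrow> 0 | Suc l \<Rightarrow> a n l) =
      a (n + 1) k + hahn_beta n \<alpha> \<beta> N * a n k + hahn_gamma n \<alpha> \<beta> N * a (n - 1) k"
      unfolding b g a_def using False s' by (intro hahn_coeff_recurrence) auto
    thus "of_nat k * a n k * p k - (case k of 0 \<Rightarrow> 0 | Suc l \<Rightarrow> a n l) * p k =
      (a (n + 1) k + hahn_beta n \<alpha> \<beta> N * a n k + hahn_gamma n \<alpha> \<beta> N * a (n - 1) k) * p k"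
      by (simp flip: left_diff_distrib)
  qed
  also have "\<dots> = hahn (int (n + 1)) \<alpha> \<beta> N x
    + hahn_beta n \<alpha> \<beta> N * hahn (int n) \<alpha> \<beta> N x + hahn_gamma n \<alpha> \<beta> N * hahn (int (n - 1)) \<alpha> \<beta> N x"
    using h[of "n + 1"] h[of n] h[of "n - 1"] False
    by (simp only: distrib_right sum.distrib sum_distrib_left) (simp add: mult.assoc)
  finally show ?thesis using False by (simp add: of_nat_diff add_ac)
qed

subsection \<open>Monic polynomials\<close>

text \<open>Writing the second difference as the first difference at \<open>x\<close> minus that at
  \<open>x - 1\<close>, the total coefficient at \<open>x\<close> becomes
  \<open>(\<alpha> + 1 + x) * (of_int N - x)\<close>, the form used for the cleared
  polynomials.\<close>

lemma hahn_difference_equation: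
  "x * (\<beta> + of_int N + 1 - x) * bwd_diff (fwd_diff (hahn (int n) \<alpha> \<beta> N)) x
     + ((\<alpha> + 1) * of_int N - (\<alpha> + \<beta> + 2) * x) * fwd_diff (hahn (int n) \<alpha> \<beta> N) x
     + of_nat n * (of_nat n + \<alpha> + \<beta> + 1) * hahn (int n) \<alpha> \<beta> N x = 0"
proof -
  define h where "h = hahn_cleared n \<alpha> \<beta> N"
  define d where "d = pochhammer (\<alpha> + \<beta> + of_nat n + 1) n"
  have hahn: "hahn (int n) \<alpha> \<beta> N y = h y / d" for y
    by (simp add: hahn_def h_def d_def)
  have "x * (\<beta> + of_int N + 1 - x) * bwd_diff (fwd_diff (hahn (int n) \<alpha> \<beta> N)) x
     + ((\<alpha> + 1) * of_int N - (\<alpha> + \<beta> + 2) * x) * fwd_diff (hahn (int n) \<alpha> \<beta> N) x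
     + of_nat n * (of_nat n + \<alpha> + \<beta> + 1) * hahn (int n) \<alpha> \<beta> N x =
    ((\<alpha> + 1 + x) * (of_int N - x) * (h (x + 1) - h x) - x * (\<beta> + of_int N + 1 - x) * (h x - h (x - 1))
     + of_nat n * (of_nat n + \<alpha> + \<beta> + 1) * h x) / d"
    \<comment> \<open>With \<open>divide_inverse\<close> the inverse of \<open>d\<close> is an atom
      and the identity is polynomial.\<close>
    unfolding bwd_diff_def fwd_diff_def hahn diff_add_cancel divide_inverse by algebra
  also have "\<dots> = 0"
    unfolding h_def hahn_cleared_difference_equation by simp
  finally show ?thesis .
qed

lemma hahn_Rodrigues:
  assumes "hahn_exists n \<alpha> \<beta>" "\<beta> + of_int N + 1 - x \<notin> \<int>\<^sub>\<le>\<^sub>0" "\<alpha> + 1 + x \<notin> \<int>\<^sub>\<le>\<^sub>0"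
  shows "hahn (int n) \<alpha> \<beta> N x * hahn_weight \<alpha> \<beta> N x =
    (- 1) ^ n / pochhammer (\<alpha> + \<beta> + of_nat n + 1) n *
      (bwd_diff ^^ n) (hahn_weight (\<alpha> + of_nat n) (\<beta> + of_nat n) (N - int n)) x"
  using hahn_cleared_Rodrigues[OF assms] by (simp add: hahn_def)

text \<open>The generating function appears twice: for the monic polynomials, where every degree
  must exist, and for \<open>hahn_cleared\<close>, which also covers sums \<alpha> + \<beta> at
  which some normalising denominator vanishes.\<close>

theorem theorem1:
  fixes N :: nat and \<alpha> \<beta> :: complex
  shows
    "((\<forall>x. hahn (- 1) \<alpha> \<beta> (int N) x = 0) \<and>
     (\<forall>x. hahn 0 \<alpha> \<beta> (int N) x = 1) \<and>
     (\<forall>n::nat. (\<forall>j. 1 \<le> j \<and> n \<le> j \<and> j \<le> 2 * n + 2 \<longrightarrow> \<alpha> + \<beta> \<noteq> - of_nat j) \<longrightarrow>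
        (\<forall>x. x * hahn (int n) \<alpha> \<beta> (int N) x =
             hahn (int n + 1) \<alpha> \<beta> (int N) x
             + hahn_beta n \<alpha> \<beta> (int N) * hahn (int n) \<alpha> \<beta> (int N) x
             + hahn_gamma n \<alpha> \<beta> (int N) * hahn (int n - 1) \<alpha> \<beta> (int N) x))) \<and>
    (\<forall>n k::nat. hahn_exists n \<alpha> \<beta> \<and> k \<le> n \<longrightarrow>
        (\<forall>x. (fwd_diff ^^ k) (hahn (int n) \<alpha> \<beta> (int N)) x =
             pochhammer (of_nat n - of_nat k + 1) k *
               hahn (int n - int k) (\<alpha> + of_nat k) (\<beta> + of_nat k) (int N - int k) x \<and>
             (bwd_diff ^^ k) (hahn (int n) \<alpha> \<beta> (int N)) x =
             pochhammer (of_nat n - of_nat k + 1) k *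
               hahn (int n - int k) (\<alpha> + of_nat k) (\<beta> + of_nat k) (int N - int k) (x - of_nat k))) \<and>
    (\<forall>n::nat. hahn_exists n \<alpha> \<beta> \<longrightarrow>
        (\<forall>x. x * (\<beta> + of_nat N + 1 - x) * bwd_diff (fwd_diff (hahn (int n) \<alpha> \<beta> (int N))) x
             + ((\<alpha> + 1) * of_nat N - (\<alpha> + \<beta> + 2) * x) * fwd_diff (hahn (int n) \<alpha> \<beta> (int N)) x
             + of_nat n * (of_nat n + \<alpha> + \<beta> + 1) * hahn (int n) \<alpha> \<beta> (int N) x = 0)) \<and>
    (\<forall>n::nat. hahn_exists n \<alpha> \<beta> \<longrightarrow>
        (\<forall>x. \<beta> + of_nat N + 1 - x \<notin> \<int>\<^sub>\<le>\<^sub>0 \<and> \<alpha> + 1 + x \<notin> \<int>\<^sub>\<le>\<^sub>0 \<longrightarrow>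
             hahn (int n) \<alpha> \<beta> (int N) x * hahn_weight \<alpha> \<beta> (int N) x =
             (- 1) ^ n / pochhammer (\<alpha> + \<beta> + of_nat n + 1) n *
               (bwd_diff ^^ n) (hahn_weight (\<alpha> + of_nat n) (\<beta> + of_nat n) (int N - int n)) x)) \<and>
    (\<alpha> + 1 \<notin> \<int>\<^sub>\<le>\<^sub>0 \<and> \<beta> + 1 \<notin> \<int>\<^sub>\<le>\<^sub>0 \<and> (\<forall>n. hahn_exists n \<alpha> \<beta>) \<longrightarrow>
        (\<forall>x t. (\<lambda>n. pochhammer (\<alpha> + \<beta> + of_nat n + 1) n
                      / (pochhammer (\<beta> + 1) n * pochhammer (\<alpha> + 1) n * fact n)
                      * hahn (int n) \<alpha> \<beta> (int N) x * t ^ n)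
               sums (hypergeo_1F1 (- x) (\<alpha> + 1) (- t) * hypergeo_1F1 (- of_nat N + x) (\<beta> + 1) t))) \<and>
    (\<alpha> + 1 \<notin> \<int>\<^sub>\<le>\<^sub>0 \<and> \<beta> + 1 \<notin> \<int>\<^sub>\<le>\<^sub>0 \<longrightarrow>
        (\<forall>x t. (\<lambda>n. hahn_cleared n \<alpha> \<beta> (int N) x
                      / (pochhammer (\<beta> + 1) n * pochhammer (\<alpha> + 1) n * fact n) * t ^ n)
               sums (hypergeo_1F1 (- x) (\<alpha> + 1) (- t) * hypergeo_1F1 (- of_nat N + x) (\<beta> + 1) t)))"
proof (intro conjI allI impI)
  fix n x assume "\<forall>j. 1 \<le> j \<and> n \<le> j \<and> j \<le> 2 * n + 2 \<longrightarrow> \<alpha> + \<beta> \<noteq> - of_nat j"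
  thus "x * hahn (int n) \<alpha> \<beta> (int N) x = hahn (int n + 1) \<alpha> \<beta> (int N) x
      + hahn_beta n \<alpha> \<beta> (int N) * hahn (int n) \<alpha> \<beta> (int N) x
      + hahn_gamma n \<alpha> \<beta> (int N) * hahn (int n - 1) \<alpha> \<beta> (int N) x"
    by (intro hahn_three_term_recurrence) blast
next
  fix n k x assume "hahn_exists n \<alpha> \<beta> \<and> k \<le> n"
  thus "(fwd_diff ^^ k) (hahn (int n) \<alpha> \<beta> (int N)) x = pochhammer (of_nat n - of_nat k + 1) k *
      hahn (int n - int k) (\<alpha> + of_nat k) (\<beta> + of_nat k) (int N - int k) x"
    "(bwd_diff ^^ k) (hahn (int n) \<alpha> \<beta> (int N)) x = pochhammer (of_nat n - of_nat k + 1) k *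
      hahn (int n - int k) (\<alpha> + of_nat k) (\<beta> + of_nat k) (int N - int k) (x - of_nat k)"
    unfolding funpow_bwd_diff_eq by (simp_all add: funpow_fwd_diff_hahn)
next
  fix n x
  show "x * (\<beta> + of_nat N + 1 - x) * bwd_diff (fwd_diff (hahn (int n) \<alpha> \<beta> (int N))) x
     + ((\<alpha> + 1) * of_nat N - (\<alpha> + \<beta> + 2) * x) * fwd_diff (hahn (int n) \<alpha> \<beta> (int N)) x
     + of_nat n * (of_nat n + \<alpha> + \<beta> + 1) * hahn (int n) \<alpha> \<beta> (int N) x = 0"
    using hahn_difference_equation[of x \<beta> "int N" n \<alpha>] by simp
next
  fix n x assume "hahn_exists n \<alpha> \<beta>" "\<beta> + of_nat N + 1 - x \<notin> \<int>\<^sub>\<le>\<^sub>0 \<and> \<alpha> + 1 + x \<notin> \<int>\<^sub>\<le>\<^sub>0"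
  thus "hahn (int n) \<alpha> \<beta> (int N) x * hahn_weight \<alpha> \<beta> (int N) x =
      (- 1) ^ n / pochhammer (\<alpha> + \<beta> + of_nat n + 1) n *
        (bwd_diff ^^ n) (hahn_weight (\<alpha> + of_nat n) (\<beta> + of_nat n) (int N - int n)) x"
    by (intro hahn_Rodrigues) simp_all
next
  fix x t assume asm: "\<alpha> + 1 \<notin> \<int>\<^sub>\<le>\<^sub>0 \<and> \<beta> + 1 \<notin> \<int>\<^sub>\<le>\<^sub>0 \<and> (\<forall>n. hahn_exists n \<alpha> \<beta>)"
  have eq: "pochhammer (\<alpha> + \<beta> + of_nat n + 1) n / (pochhammer (\<beta> + 1) n * pochhammer (\<alpha> + 1) n * fact n)
      * hahn (int n) \<alpha> \<beta> (int N) x =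
      hahn_cleared n \<alpha> \<beta> (int N) x / (pochhammer (\<beta> + 1) n * pochhammer (\<alpha> + 1) n * fact n)" for n
    using asm by (simp add: hahn_def hahn_exists_def)
  show "(\<lambda>n. pochhammer (\<alpha> + \<beta> + of_nat n + 1) n / (pochhammer (\<beta> + 1) n * pochhammer (\<alpha> + 1) n * fact n)
      * hahn (int n) \<alpha> \<beta> (int N) x * t ^ n)
    sums (hypergeo_1F1 (- x) (\<alpha> + 1) (- t) * hypergeo_1F1 (- of_nat N + x) (\<beta> + 1) t)"
    unfolding eq using hahn_cleared_generating_function[of \<alpha> \<beta> "int N" x t] asm by simp
next
  fix x t assume "\<alpha> + 1 \<notin> \<int>\<^sub>\<le>\<^sub>0 \<and> \<beta> + 1 \<notin> \<int>\<^sub>\<le>\<^sub>0"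
  thus "(\<lambda>n. hahn_cleared n \<alpha> \<beta> (int N) x / (pochhammer (\<beta> + 1) n * pochhammer (\<alpha> + 1) n * fact n) * t ^ n)
    sums (hypergeo_1F1 (- x) (\<alpha> + 1) (- t) * hypergeo_1F1 (- of_nat N + x) (\<beta> + 1) t)"
    using hahn_cleared_generating_function[of \<alpha> \<beta> "int N" x t] by simp
qed (simp_all add: hahn_def hahn_cleared_def)

end
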